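(* Let $G$ be an $r$-cop-win graph ($r\in\{0,1\}$) of finite corner rank $\alpha\ge2$. (1) If for some $t\ge1$, after $t$ cop moves the cop has $k$-cornered the robber for some $k\le\alpha-r-t$ (condition LW at time $t$), then the cop can play so that condition LW holds at every later time $t'\ge t$ for the rest of the game, i.e., after $t'$ cop moves she $k$-corners the robber for some $k\le\alpha-r-t'$. (2) If for some $t\ge1$, after $t$ cop moves the cop has $k$-caught the robber for some $k\le\alpha-r-t+1$ (condition C at time $t$), then the cop can play so that after $t'$ cop moves she has $k$-caught the robber for some $k\le\alpha-r-t'+1$, for every later $t'\ge t$ for the rest of the game.
   Context: All graphs are finite, nonempty and reflexive (every vertex adjacent to itself). For distinct vertices $v,w$ of a graph $H$: $w$ corners $v$ in $H$ if every vertex of $H$ adjacent to $v$ is adjacent to $w$; $w$ strictly corners $v$ in $H$ if moreover some vertex of $H$ adjacent to $w$ is not adjacent to $v$; a strict corner of $H$ is a vertex strictly cornered in $H$ by another vertex. We also say $c$ corners $x$ in $H$ when $c=x$. Corner ranking: $G_1=G$, $k=1$. If $G_k$ is a clique, its vertices get rank $k$; stop. Else if $G_k$ has no strict corners, its vertices get rank $\infty$; stop. Else the set $X$ of strict corners of $G_k$ gets rank $k$, $G_{k+1}=G_k-X$, increase $k$, repeat. $\mathrm{cr}(v)$ is the rank of $v$, $\mathrm{cr}(G)$ the maximum rank. For finite corner rank $\alpha\ge2$: $G$ is $1$-cop-win if some (equivalently every) vertex of rank $\alpha$ is adjacent to all vertices of $G_{\alpha-1}$, otherwise $0$-cop-win.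 Projections: $f_k(\{u\})=\{u\}$ if $\mathrm{cr}(u)>k$, otherwise the set of vertices of $G_{k+1}$ that strictly corner $u$ in $G_k$; $f_k(S)=\bigcup_{u\in S}f_k(\{u\})$; $F_1$ the identity, $F_k=f_{k-1}\circ\cdots\circ f_1$, $F_k(v)=F_k(\{v\})$. Game: cop places, robber places, then alternate moves with the cop first; a move is staying or moving to an adjacent vertex; the cop wins when both share a vertex. With the cop at $c$ and robber at $x$: $x$ is $0$-cornered if $c=x$; for $k\ge1$, $x$ is $k$-cornered by $c$ if some $x'\in F_k(x)$ is cornered by $c$ in the subgraph induced by $V(G_k)\cup\{c\}$; for $k\ge 1$ the cop has $k$-caught the robber if $c\in F_k(x)$. *)

theory Defs
  imports "Graph_Theory.Digraph_Component" "HOL-Library.Extended_Nat"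
begin

text \<open>
  A finite nonempty reflexive graph is a finite symmetric digraph without multiple arcs in which
  every vertex has a loop; \<open>u\<close> and \<open>v\<close> are adjacent in \<open>G\<close> iff \<open>u \<rightarrow>\<^bsub>G\<^esub> v\<close>.
\<close>

locale reflexive_graph = pseudo_graph G + nomulti_digraph G
  for G :: "('a, 'b) pre_digraph" +
  assumes nonempty: "verts G \<noteq> {}"
    and loops: "v \<in> verts G \<Longrightarrow> v \<rightarrow>\<^bsub>G\<^esub> v"

definition is_clique :: "('a, 'b) pre_digraph \<Rightarrow> bool" where
  "is_clique H \<longleftrightarrow> (\<forall>u\<in>verts H. \<forall>v\<in>verts H. u \<rightarrow>\<^bsub>H\<^esub> v)"


section \<open>Corners and corner ranking\<close>

text \<open>Every vertex also corners itself; strict cornering forces the two vertices to be distinct.\<close>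

definition corners :: "('a, 'b) pre_digraph \<Rightarrow> 'a \<Rightarrow> 'a \<Rightarrow> bool" where
  "corners H w v \<longleftrightarrow> w \<in> verts H \<and> v \<in> verts H \<and>
     (w = v \<or> (\<forall>z\<in>verts H. z \<rightarrow>\<^bsub>H\<^esub> v \<longrightarrow> z \<rightarrow>\<^bsub>H\<^esub> w))"

definition strictly_corners :: "('a, 'b) pre_digraph \<Rightarrow> 'a \<Rightarrow> 'a \<Rightarrow> bool" where
  "strictly_corners H w v \<longleftrightarrow> w \<noteq> v \<and> corners H w v \<and>
     (\<exists>z\<in>verts H. z \<rightarrow>\<^bsub>H\<^esub> w \<and> \<not> z \<rightarrow>\<^bsub>H\<^esub> v)"

definition strict_corner_set :: "('a, 'b) pre_digraph \<Rightarrow> 'a set" where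
  "strict_corner_set H = {v \<in> verts H. \<exists>w\<in>verts H. strictly_corners H w v}"

text \<open>
  \<open>rank_graph G k\<close> is the graph \<open>G\<^sub>k\<close>, so \<open>k \<ge> 1\<close> is intended. Stopping need not be
  encoded: a clique has no strict corners, so in both stopping cases nothing is removed and the
  sequence is constant from there on.
\<close>

definition rank_graph :: "('a, 'b) pre_digraph \<Rightarrow> nat \<Rightarrow> ('a, 'b) pre_digraph" where
  "rank_graph G k = ((\<lambda>H. H \<restriction> (verts H - strict_corner_set H)) ^^ (k - 1)) G"

text \<open>
  The set of vertices that step \<open>k\<close> of the ranking assigns rank \<open>k\<close>. If \<open>G\<^sub>k\<close> is a clique, later
  steps would reassign its vertices, which is why the least such \<open>k\<close> is taken below. If the process
  stops at a graph that is not a clique, the sets are empty from there on.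
\<close>

definition rank_step :: "('a, 'b) pre_digraph \<Rightarrow> nat \<Rightarrow> 'a set" where
  "rank_step G k = (if is_clique (rank_graph G k) then verts (rank_graph G k)
                    else strict_corner_set (rank_graph G k))"

definition corner_rank :: "('a, 'b) pre_digraph \<Rightarrow> 'a \<Rightarrow> enat" where
  "corner_rank G v = (if \<exists>k\<ge>1. v \<in> rank_step G k
                      then enat (LEAST k. 1 \<le> k \<and> v \<in> rank_step G k) else \<infinity>)"

definition graph_corner_rank :: "('a, 'b) pre_digraph \<Rightarrow> enat" where
  "graph_corner_rank G = Max (corner_rank G ` verts G)"

text \<open>\<open>cop_win_type G r\<close>: the graph \<open>G\<close> is \<open>r\<close>-cop-win.\<close>

definition cop_win_type :: "('a, 'b) pre_digraph \<Rightarrow> nat \<Rightarrow> bool" where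
  "cop_win_type G r \<longleftrightarrow> (\<exists>\<alpha>\<ge>2. graph_corner_rank G = enat \<alpha> \<and>
     r = (if \<exists>v\<in>verts G. corner_rank G v = enat \<alpha> \<and> (\<forall>u\<in>verts (rank_graph G (\<alpha> - 1)). v \<rightarrow>\<^bsub>G\<^esub> u)
          then 1 else 0))"


section \<open>Projections, cornering and catching\<close>

definition proj1 :: "('a, 'b) pre_digraph \<Rightarrow> nat \<Rightarrow> 'a \<Rightarrow> 'a set" where
  "proj1 G k u = (if corner_rank G u > enat k then {u}
     else {w \<in> verts (rank_graph G (k + 1)). strictly_corners (rank_graph G k) w u})"

definition proj :: "('a, 'b) pre_digraph \<Rightarrow> nat \<Rightarrow> 'a set \<Rightarrow> 'a set" where
  "proj G k S = (\<Union>u\<in>S. proj1 G k u)"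

text \<open>\<open>Proj G k\<close> is \<open>F\<^sub>k\<close>; the value at \<open>k = 0\<close> is a dummy.\<close>

fun Proj :: "('a, 'b) pre_digraph \<Rightarrow> nat \<Rightarrow> 'a set \<Rightarrow> 'a set" where
  "Proj G 0 S = S"
| "Proj G (Suc 0) S = S"
| "Proj G (Suc (Suc k)) S = proj G (Suc k) (Proj G (Suc k) S)"

text \<open>In the following, \<open>c\<close> is the cop's vertex and \<open>x\<close> the robber's vertex.\<close>

definition k_cornered :: "('a, 'b) pre_digraph \<Rightarrow> nat \<Rightarrow> 'a \<Rightarrow> 'a \<Rightarrow> bool" where
  "k_cornered G k c x \<longleftrightarrow>
     (if k = 0 then c = x
      else \<exists>x'\<in>Proj G k {x}. corners (G \<restriction> (verts (rank_graph G k) \<union> {c})) c x')"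

definition k_caught :: "('a, 'b) pre_digraph \<Rightarrow> nat \<Rightarrow> 'a \<Rightarrow> 'a \<Rightarrow> bool" where
  "k_caught G k c x \<longleftrightarrow> 1 \<le> k \<and> c \<in> Proj G k {x}"

definition cond_LW :: "('a, 'b) pre_digraph \<Rightarrow> nat \<Rightarrow> nat \<Rightarrow> nat \<Rightarrow> 'a \<Rightarrow> 'a \<Rightarrow> bool" where
  "cond_LW G \<alpha> r t c x \<longleftrightarrow> (\<exists>k. int k \<le> int \<alpha> - int r - int t \<and> k_cornered G k c x)"

definition cond_C :: "('a, 'b) pre_digraph \<Rightarrow> nat \<Rightarrow> nat \<Rightarrow> nat \<Rightarrow> 'a \<Rightarrow> 'a \<Rightarrow> bool" where
  "cond_C G \<alpha> r t c x \<longleftrightarrow> (\<exists>k\<ge>1. int k \<le> int \<alpha> - int r - int t + 1 \<and> k_caught G k c x)"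


section \<open>The game\<close>

text \<open>
  The cop's and robber's vertices are given by sequences \<open>c\<close> and \<open>x\<close>, where \<open>c 0\<close> and \<open>x 0\<close> are the
  initial placements and \<open>c i\<close>, \<open>x i\<close> the vertices after the \<open>i\<close>-th move of the respective player.
  As the cop moves first, right after her \<open>t\<close>-th move (\<open>t \<ge> 1\<close>) the cop is at \<open>c t\<close> and the robber
  at \<open>x (t - 1)\<close>. The predicate \<open>play_upto G c x t\<close> says that \<open>c 0, x 0, c 1, x 1, \<dots>, x (t - 1), c t\<close>
  is a legal play in which the robber was not caught before the cop's \<open>t\<close>-th move, i.e. that
  the game does last for \<open>t\<close> cop moves. Staying put is legal because of the loops.
\<close>

definition play_upto :: "('a, 'b) pre_digraph \<Rightarrow> (nat \<Rightarrow> 'a) \<Rightarrow> (nat \<Rightarrow> 'a) \<Rightarrow> nat \<Rightarrow> bool" where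
  "play_upto G c x t \<longleftrightarrow>
     (\<forall>i\<le>t. c i \<in> verts G) \<and> (\<forall>i<t. x i \<in> verts G) \<and>
     (\<forall>i<t. c i \<rightarrow>\<^bsub>G\<^esub> c (Suc i)) \<and> (\<forall>i. Suc i < t \<longrightarrow> x i \<rightarrow>\<^bsub>G\<^esub> x (Suc i)) \<and>
     (\<forall>i<t. c i \<noteq> x i) \<and> (\<forall>i. Suc i < t \<longrightarrow> c (Suc i) \<noteq> x i)"

text \<open>
  A cop strategy maps the history \<open>[(c 0, x 0), \<dots>, (c i, x i)]\<close>, after which the cop is to move,
  to the vertex \<open>c (i + 1)\<close>; it must always be a legal move.
\<close>

definition history :: "(nat \<Rightarrow> 'a) \<Rightarrow> (nat \<Rightarrow> 'a) \<Rightarrow> nat \<Rightarrow> ('a \<times> 'a) list" where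
  "history c x i = map (\<lambda>j. (c j, x j)) [0..<Suc i]"

definition cop_strategy :: "('a, 'b) pre_digraph \<Rightarrow> (('a \<times> 'a) list \<Rightarrow> 'a) \<Rightarrow> bool" where
  "cop_strategy G \<sigma> \<longleftrightarrow>
     (\<forall>h. h \<noteq> [] \<and> set h \<subseteq> verts G \<times> verts G \<longrightarrow> fst (last h) \<rightarrow>\<^bsub>G\<^esub> \<sigma> h)"

text \<open>
  Given a play that has reached the cop's \<open>t\<close>-th move, the cop can play from then on so that,
  however the robber moves, \<open>P t' (cop's vertex) (robber's vertex)\<close> holds after her \<open>t'\<close>-th move for
  all \<open>t' \<ge> t\<close> for which the game lasts for \<open>t'\<close> cop moves.
\<close>

definition cop_can_maintain ::
  "('a, 'b) pre_digraph \<Rightarrow> (nat \<Rightarrow> 'a \<Rightarrow> 'a \<Rightarrow> bool) \<Rightarrow> (nat \<Rightarrow> 'a) \<Rightarrow> (nat \<Rightarrow> 'a) \<Rightarrow> nat \<Rightarrow> bool" where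
  "cop_can_maintain G P c x t \<longleftrightarrow>
     (\<exists>\<sigma>. cop_strategy G \<sigma> \<and>
       (\<forall>c' x' t'. t \<le> t' \<and> (\<forall>i\<le>t. c' i = c i) \<and> (\<forall>i<t. x' i = x i) \<and> play_upto G c' x' t' \<and>
          (\<forall>i. t \<le> i \<and> i < t' \<longrightarrow> c' (Suc i) = \<sigma> (history c' x' i)) \<longrightarrow>
          P t' (c' t') (x' (t' - 1))))"

end

theory Submission
  imports Defs
begin

text \<open>
  The projections \<open>f\<^sub>k\<close> send adjacent vertices to adjacent vertices, and below the corner rank they
  never vanish, so the projection \<open>F\<^sub>k\<close> of the robber is always a nonempty shadow of him in \<open>G\<^sub>k\<close>.
  A cop who corners a shadow in \<open>G\<^sub>k\<close> can step onto every shadow \<open>y'\<close> that the robber's next move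
  produces in \<open>G\<^sub>k\<close>; since \<open>y'\<close> corners a shadow in \<open>G\<^bsub>k-1\<^esub>\<close>, each round costs exactly one level.
  Similarly, a cop who stands on a shadow in \<open>G\<^sub>k\<close> corners a shadow in \<open>G\<^bsub>k-1\<^esub>\<close>, so she can step
  onto the next shadow there.
\<close>

section \<open>The ranking graphs as a decreasing chain of induced subgraphs\<close>

lemma dominates_induce_subgraph_iff:
  "u \<rightarrow>\<^bsub>H \<restriction> S\<^esub> v \<longleftrightarrow> u \<in> S \<and> v \<in> S \<and> u \<rightarrow>\<^bsub>H\<^esub> v"
  by (auto simp: arcs_ends_def arc_to_ends_def)

lemma rank_graph_1 [simp]: "rank_graph G (Suc 0) = G"
  by (simp add: rank_graph_def)

lemma rank_graph_Suc:
  assumes "k \<ge> 1"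
  shows "rank_graph G (Suc k) =
    rank_graph G k \<restriction> (verts (rank_graph G k) - strict_corner_set (rank_graph G k))"
proof -
  obtain j where "k = Suc j" using assms by (cases k) auto
  then show ?thesis by (simp add: rank_graph_def)
qed

lemma verts_rank_graph_Suc:
  "k \<ge> 1 \<Longrightarrow> verts (rank_graph G (Suc k)) =
    verts (rank_graph G k) - strict_corner_set (rank_graph G k)"
  by (simp add: rank_graph_Suc)

lemma verts_rank_graph_antimono:
  assumes "1 \<le> j" "j \<le> k"
  shows "verts (rank_graph G k) \<subseteq> verts (rank_graph G j)"
  using assms(2,1) by (induction rule: dec_induct) (auto simp: verts_rank_graph_Suc)

lemma verts_rank_graph_subset:
  "k \<ge> 1 \<Longrightarrow> verts (rank_graph G k) \<subseteq> verts G"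
  using verts_rank_graph_antimono[of 1 k G] by simp

text \<open>Induced subgraphs of induced subgraphs are induced. This lets later adjacencies be
  stated in \<open>G\<close> alone.\<close>

lemma (in reflexive_graph) dominates_rank_graph_iff:
  assumes "k \<ge> 1"
  shows "u \<rightarrow>\<^bsub>rank_graph G k\<^esub> v \<longleftrightarrow>
    u \<in> verts (rank_graph G k) \<and> v \<in> verts (rank_graph G k) \<and> u \<rightarrow>\<^bsub>G\<^esub> v"
  using assms
proof (induction k rule: nat_induct_at_least)
  case base
  then show ?case by (auto dest: adj_in_verts)
next
  case (Suc k)
  then show ?case
    by (auto simp: rank_graph_Suc dominates_induce_subgraph_iff)
qed

lemma (in reflexive_graph) dominates_commute: "u \<rightarrow>\<^bsub>G\<^esub> v \<longleftrightarrow> v \<rightarrow>\<^bsub>G\<^esub> u"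
  using graph_symmetric by blast

section \<open>Strict corners and their link to corner ranks\<close>

lemma strictly_corners_trans:
  assumes "strictly_corners H w v" "strictly_corners H v u"
  shows "strictly_corners H w u"
  using assms unfolding strictly_corners_def corners_def by blast

text \<open>A maximal vertex among those strictly cornering \<open>u\<close> is itself not strictly cornered.\<close>

lemma strict_corner_surviving:
  assumes "finite (verts H)" "u \<in> strict_corner_set H"
  obtains w where "w \<in> verts H - strict_corner_set H" "strictly_corners H w u"
proof -
  define S where "S = {w \<in> verts H. strictly_corners H w u}"
  have "finite S" "S \<noteq> {}" using assms by (auto simp: S_def strict_corner_set_def)
  moreover have "asymp_on S (strictly_corners H)"
    by (rule asymp_onI) (auto simp: strictly_corners_def corners_def)
  moreover have "transp_on S (strictly_corners H)"
    by (rule transp_onI) (rule strictly_corners_trans)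
  \<comment> \<open>The cornering vertex counts as the smaller one here, so a minimal element of
    \<open>S\<close> is one that no other element of \<open>S\<close> strictly corners.\<close>
  ultimately obtain m where m: "m \<in> S" "\<And>w. w \<in> S \<Longrightarrow> w \<noteq> m \<Longrightarrow> \<not> strictly_corners H w m"
    using Finite_Set.bex_min_element[of S "strictly_corners H"] by auto
  have "\<not> strictly_corners H w m" if "w \<in> verts H" for w
  proof
    assume wm: "strictly_corners H w m"
    then have "w \<in> S" using strictly_corners_trans[OF wm] m(1) that by (simp add: S_def)
    then show False using m(2) wm by (auto simp: strictly_corners_def)
  qed
  then show thesis using that[of m] m(1) by (simp add: S_def strict_corner_set_def)
qed

text \<open>If \<open>rank_graph G k\<close> were a clique, its vertices would be ranked at step
  \<open>k\<close> at the latest and all others earlier, on their removal. The maximum rank would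
  then be at most \<open>k\<close>.\<close>

lemma not_clique_below_rank:
  assumes "finite (verts G)" "verts G \<noteq> {}" "graph_corner_rank G = enat \<alpha>" "1 \<le> k" "k < \<alpha>"
  shows "\<not> is_clique (rank_graph G k)"
proof
  assume clique: "is_clique (rank_graph G k)"
  have le: "corner_rank G v \<le> enat j" if "1 \<le> j" "v \<in> rank_step G j" for v j
    using that by (auto simp: corner_rank_def intro: Least_le)
  have "corner_rank G v \<le> enat k" if v: "v \<in> verts G" for v
  proof (cases "v \<in> verts (rank_graph G k)")
    case True
    then show ?thesis using le[of k v] clique assms by (simp add: rank_step_def)
  next
    case False
    have "\<exists>j. 1 \<le> j \<and> j < k \<and> v \<in> strict_corner_set (rank_graph G j)"
      using assms(4) False
    proof (induction k rule: nat_induct_at_least)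
      case base
      then show ?case using v by simp
    next
      case (Suc n)
      then show ?case by (auto simp: verts_rank_graph_Suc less_Suc_eq)
    qed
    then obtain j where j: "1 \<le> j" "j < k" "v \<in> strict_corner_set (rank_graph G j)" by blast
    \<comment> \<open>Both branches of \<open>rank_step\<close> contain the strict corners, so it
      does not matter here whether \<open>rank_graph G j\<close> is a clique.\<close>
    then have "v \<in> rank_step G j"
      by (auto simp: rank_step_def strict_corner_set_def)
    then have "corner_rank G v \<le> enat j" using le j by blast
    then show ?thesis using j(2) by (meson enat_ord_simps(1) less_imp_le order_trans)
  qed
  then have "graph_corner_rank G \<le> enat k"
    using assms(1,2) by (simp add: graph_corner_rank_def)
  then show False using assms(3,5) by simp
qed

text \<open>While no clique has occurred, ranks are given only by removal, and a vertex of
  \<open>rank_graph G k\<close> has escaped all earlier removals. This turns the rank test in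
  \<open>proj1\<close> into a statement about the ranking graphs.\<close>

lemma corner_rank_le_iff:
  assumes nc: "\<And>j. 1 \<le> j \<Longrightarrow> j \<le> k \<Longrightarrow> \<not> is_clique (rank_graph G j)"
    and "1 \<le> k" "u \<in> verts (rank_graph G k)"
  shows "corner_rank G u \<le> enat k \<longleftrightarrow> u \<in> strict_corner_set (rank_graph G k)"
proof
  assume "corner_rank G u \<le> enat k"
  then have ex: "\<exists>j\<ge>1. u \<in> rank_step G j"
    and le: "(LEAST j. 1 \<le> j \<and> u \<in> rank_step G j) \<le> k"
    by (auto simp: corner_rank_def split: if_splits)
  define j where "j = (LEAST j. 1 \<le> j \<and> u \<in> rank_step G j)"
  have j: "1 \<le> j" "u \<in> rank_step G j"
    using LeastI_ex[OF ex] by (auto simp: j_def)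
  have "j \<le> k" using le by (simp add: j_def)
  then have u: "u \<in> strict_corner_set (rank_graph G j)"
    using j nc by (simp add: rank_step_def)
  then have "u \<notin> verts (rank_graph G (Suc j))" using j by (simp add: verts_rank_graph_Suc)
  then have "\<not> Suc j \<le> k" using assms(3) verts_rank_graph_antimono[of "Suc j" k G] by auto
  then show "u \<in> strict_corner_set (rank_graph G k)" using u \<open>j \<le> k\<close> by (simp add: not_less_eq_eq)
next
  assume "u \<in> strict_corner_set (rank_graph G k)"
  then have "u \<in> rank_step G k" using nc assms(2) by (simp add: rank_step_def)
  then show "corner_rank G u \<le> enat k"
    using assms(2) by (auto simp: corner_rank_def intro: Least_le)
qed

section \<open>Projections and the shadows of the robber\<close>

context reflexive_graph
begin

text \<open>If the rank of \<open>u\<close> exceeds \<open>k\<close>, then \<open>w\<close> is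
  \<open>u\<close>, which survives step \<open>k\<close> and corners itself. Otherwise both claims
  come from the definition of \<open>proj1\<close>.\<close>

lemma proj1_cornersD:
  assumes "graph_corner_rank G = enat \<alpha>" "1 \<le> k" "k < \<alpha>"
    and "u \<in> verts (rank_graph G k)" "w \<in> proj1 G k u"
  shows "w \<in> verts (rank_graph G (Suc k))" "corners (rank_graph G k) w u"
proof -
  have nc: "\<not> is_clique (rank_graph G j)" if "1 \<le> j" "j \<le> k" for j
    using that not_clique_below_rank[of G \<alpha> j] assms nonempty by simp
  show "w \<in> verts (rank_graph G (Suc k))"
    using corner_rank_le_iff[OF nc] assms
    by (auto simp: proj1_def verts_rank_graph_Suc not_le[symmetric] split: if_splits)
  show "corners (rank_graph G k) w u"
    using assms by (auto simp: proj1_def strictly_corners_def corners_def split: if_splits)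
qed

text \<open>A vertex of rank at most \<open>k\<close> is a strict corner here, and some vertex
  strictly cornering it survives step \<open>k\<close>.\<close>

lemma proj1_nonempty:
  assumes "graph_corner_rank G = enat \<alpha>" "1 \<le> k" "k < \<alpha>" "u \<in> verts (rank_graph G k)"
  shows "proj1 G k u \<noteq> {}"
proof (cases "corner_rank G u > enat k")
  case True
  then show ?thesis by (simp add: proj1_def)
next
  case False
  have nc: "\<not> is_clique (rank_graph G j)" if "1 \<le> j" "j \<le> k" for j
    using that not_clique_below_rank[of G \<alpha> j] assms nonempty by simp
  have "finite (verts (rank_graph G k))"
    using verts_rank_graph_subset[OF assms(2)] finite_verts by (rule finite_subset)
  moreover have "u \<in> strict_corner_set (rank_graph G k)"
    using corner_rank_le_iff[OF nc assms(2,4)] False by auto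
  ultimately obtain w where "w \<in> verts (rank_graph G k) - strict_corner_set (rank_graph G k)"
    "strictly_corners (rank_graph G k) w u"
    by (rule strict_corner_surviving)
  then show ?thesis using False assms(2) by (auto simp: proj1_def verts_rank_graph_Suc)
qed

lemma cornersD:
  assumes "k \<ge> 1" "corners (rank_graph G k) w u" "z \<in> verts (rank_graph G k)" "z \<rightarrow>\<^bsub>G\<^esub> u"
  shows "z \<rightarrow>\<^bsub>G\<^esub> w"
  using assms by (auto simp: corners_def dominates_rank_graph_iff)

lemma Proj_Suc: "k \<ge> 1 \<Longrightarrow> Proj G (Suc k) S = (\<Union>u\<in>Proj G k S. proj1 G k u)"
  by (cases k) (auto simp: proj_def)

lemma Proj_subset:
  assumes "graph_corner_rank G = enat \<alpha>" "x \<in> verts G" "1 \<le> k" "k \<le> \<alpha>"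
  shows "Proj G k {x} \<subseteq> verts (rank_graph G k)"
  using assms(3,4)
proof (induction k rule: nat_induct_at_least)
  case base
  then show ?case using assms by simp
next
  case (Suc k)
  then show ?case using proj1_cornersD(1)[OF assms(1)] by (fastforce simp: Proj_Suc)
qed

lemma Proj_nonempty:
  assumes "graph_corner_rank G = enat \<alpha>" "x \<in> verts G" "1 \<le> k" "k \<le> \<alpha>"
  shows "Proj G k {x} \<noteq> {}"
  using assms(3,4)
proof (induction k rule: nat_induct_at_least)
  case base
  then show ?case by simp
next
  case (Suc k)
  then obtain u where "u \<in> Proj G k {x}" by auto
  moreover then have "u \<in> verts (rank_graph G k)"
    using Proj_subset[OF assms(1,2), of k] Suc by auto
  then have "proj1 G k u \<noteq> {}" using proj1_nonempty[OF assms(1)] Suc by simp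
  ultimately show ?case using Suc by (auto simp: Proj_Suc)
qed

text \<open>Passing to the next level replaces each end of the edge \<open>u0\<close>,
  \<open>v0\<close> by a vertex cornering it, one end at a time; each replacement keeps the
  adjacency.\<close>

lemma Proj_adjacent:
  assumes "graph_corner_rank G = enat \<alpha>" "x \<rightarrow>\<^bsub>G\<^esub> y" "1 \<le> k" "k \<le> \<alpha>"
    and "u \<in> Proj G k {x}" "v \<in> Proj G k {y}"
  shows "u \<rightarrow>\<^bsub>G\<^esub> v"
  using assms(3-)
proof (induction k arbitrary: u v rule: nat_induct_at_least)
  case base
  then show ?case using assms(2) by simp
next
  case (Suc k)
  have xy: "x \<in> verts G" "y \<in> verts G" using assms(2) adj_in_verts by auto
  obtain u0 v0 where u0: "u0 \<in> Proj G k {x}" "u \<in> proj1 G k u0"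
    and v0: "v0 \<in> Proj G k {y}" "v \<in> proj1 G k v0"
    using Suc by (auto simp: Proj_Suc)
  have k: "k < \<alpha>" "k \<le> \<alpha>" using Suc by auto
  have mem: "u0 \<in> verts (rank_graph G k)" "v0 \<in> verts (rank_graph G k)"
    using u0 v0 xy Proj_subset[OF assms(1) _ Suc(1) k(2)] by auto
  have cu: "corners (rank_graph G k) u u0" and cv: "corners (rank_graph G k) v v0"
    using proj1_cornersD(2)[OF assms(1) Suc(1) k(1)] mem u0 v0 by auto
  have "u0 \<rightarrow>\<^bsub>G\<^esub> v0" using Suc.IH k u0 v0 by blast
  then have "v0 \<rightarrow>\<^bsub>G\<^esub> u" using cornersD[OF Suc(1) cu mem(2)] dominates_commute by blast
  \<comment> \<open>Cornering controls only neighbours inside \<open>rank_graph G k\<close>, so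
    \<open>u\<close> must lie there before \<open>v0\<close> can be replaced by
    \<open>v\<close>.\<close>
  moreover have "u \<in> verts (rank_graph G k)" using cu by (simp add: corners_def)
  ultimately show "u \<rightarrow>\<^bsub>G\<^esub> v" using cornersD[OF Suc(1) cv] dominates_commute by blast
qed

section \<open>One round of the game\<close>

lemma k_cornered_step:
  assumes \<alpha>: "graph_corner_rank G = enat \<alpha>" and "Suc k \<le> \<alpha>"
    and cor: "k_cornered G (Suc k) c x" and xy: "x \<rightarrow>\<^bsub>G\<^esub> y"
  shows "\<exists>d. c \<rightarrow>\<^bsub>G\<^esub> d \<and> k_cornered G k d y"
proof -
  let ?V = "verts (rank_graph G (Suc k))"
  have verts: "x \<in> verts G" "y \<in> verts G" using xy adj_in_verts by auto
  obtain x' where x': "x' \<in> Proj G (Suc k) {x}" "corners (G \<restriction> (?V \<union> {c})) c x'"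
    using cor by (auto simp: k_cornered_def)
  obtain y' where y': "y' \<in> Proj G (Suc k) {y}"
    using Proj_nonempty[OF \<alpha> verts(2), of "Suc k"] assms(2) by auto
  have "x' \<rightarrow>\<^bsub>G\<^esub> y'" using Proj_adjacent[OF \<alpha> xy _ assms(2) x'(1) y'] by simp
  moreover have "x' \<in> ?V" "y' \<in> ?V"
    using Proj_subset[OF \<alpha> verts(1), of "Suc k"] Proj_subset[OF \<alpha> verts(2), of "Suc k"]
      x' y' assms(2) by auto
  \<comment> \<open>The new shadow \<open>y'\<close> is a neighbour of \<open>x'\<close> inside the
    very subgraph in which \<open>c\<close> corners \<open>x'\<close>.\<close>
  ultimately have "c \<rightarrow>\<^bsub>G\<^esub> y'"
    using x'(2) dominates_commute by (auto simp: corners_def dominates_induce_subgraph_iff)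
  moreover have "k_cornered G k y' y"
  \<comment> \<open>For \<open>k = 0\<close> the shadow was taken at level 1, where the projection
    is the identity. Hence \<open>y'\<close> is \<open>y\<close> and the cop has captured the
    robber.\<close>
  proof (cases "k = 0")
    case True
    then show ?thesis using y' by (simp add: k_cornered_def)
  next
    case False
    then obtain y0 where y0: "y0 \<in> Proj G k {y}" "y' \<in> proj1 G k y0"
      using y' by (auto simp: Proj_Suc)
    have "y0 \<in> verts (rank_graph G k)"
      using Proj_subset[OF \<alpha> verts(2), of k] y0 False assms(2) by auto
    then have "corners (rank_graph G k) y' y0"
      using proj1_cornersD(2)[OF \<alpha>] y0 False assms(2) by auto
    \<comment> \<open>Since \<open>y'\<close> already lies in \<open>rank_graph G k\<close>,
      adjoining it changes nothing.\<close>
    then have "corners (G \<restriction> (verts (rank_graph G k) \<union> {y'})) y' y0"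
      using False by (auto simp: corners_def dominates_induce_subgraph_iff dominates_rank_graph_iff)
    then show ?thesis using y0 False by (auto simp: k_cornered_def)
  qed
  ultimately show ?thesis by blast
qed

text \<open>A shadow at level \<open>Suc k\<close> is a projection of some shadow \<open>u\<close>
  at level \<open>k\<close>, so it corners \<open>u\<close> there. It is therefore adjacent to every
  level-\<open>k\<close> shadow of \<open>y\<close>, as \<open>u\<close> is.\<close>

lemma k_caught_step:
  assumes \<alpha>: "graph_corner_rank G = enat \<alpha>" and k: "1 \<le> k" "Suc k \<le> \<alpha>"
    and caught: "k_caught G (Suc k) c x" and xy: "x \<rightarrow>\<^bsub>G\<^esub> y"
  shows "\<exists>d. c \<rightarrow>\<^bsub>G\<^esub> d \<and> k_caught G k d y"
proof -
  have verts: "x \<in> verts G" "y \<in> verts G" using xy adj_in_verts by auto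
  obtain u where u: "u \<in> Proj G k {x}" "c \<in> proj1 G k u"
    using caught k by (auto simp: k_caught_def Proj_Suc)
  obtain d where d: "d \<in> Proj G k {y}"
    using Proj_nonempty[OF \<alpha> verts(2), of k] k by auto
  have mem: "u \<in> verts (rank_graph G k)" "d \<in> verts (rank_graph G k)"
    using Proj_subset[OF \<alpha> verts(1), of k] Proj_subset[OF \<alpha> verts(2), of k] u d k by auto
  have "u \<rightarrow>\<^bsub>G\<^esub> d" using Proj_adjacent[OF \<alpha> xy k(1)] k u d by simp
  moreover have "corners (rank_graph G k) c u"
    using proj1_cornersD(2)[OF \<alpha> k(1)] k mem u by simp
  ultimately have "c \<rightarrow>\<^bsub>G\<^esub> d" using cornersD[OF k(1) _ mem(2)] dominates_commute by blast
  then show ?thesis using d k by (auto simp: k_caught_def)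
qed

section \<open>From single rounds to a strategy for the rest of the game\<close>

lemma cop_can_maintain_if_step:
  assumes step: "\<And>s d u v. \<lbrakk>s \<ge> 1; P s d u; d \<noteq> u; u \<rightarrow>\<^bsub>G\<^esub> v\<rbrakk> \<Longrightarrow> \<exists>e. d \<rightarrow>\<^bsub>G\<^esub> e \<and> P (Suc s) e v"
    and "t \<ge> 1" "P t (c t) (x (t - 1))"
  shows "cop_can_maintain G P c x t"
proof -
  \<comment> \<open>A history of length \<open>n\<close> ends just before the cop's
    \<open>n\<close>-th move, since it starts with the placements at index 0. So
    \<open>length h\<close> is the index of the move to be chosen.\<close>
  define Q where "Q h e \<longleftrightarrow> fst (last h) \<rightarrow>\<^bsub>G\<^esub> e \<and> P (length h) e (snd (last h))" for h e
  \<comment> \<open>Where no move preserves \<open>P\<close>, the cop stays put; the loops make this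
    legal, as a strategy must be legal on every history.\<close>
  define \<sigma> where "\<sigma> h = (if \<exists>e. Q h e then SOME e. Q h e else fst (last h))" for h
  have \<sigma>: "Q h (\<sigma> h)" if "Q h e" for h e
    using that someI[of "Q h" e] by (auto simp: \<sigma>_def)
  have "cop_strategy G \<sigma>"
    unfolding cop_strategy_def
  proof (intro allI impI, elim conjE)
    fix h assume h: "h \<noteq> []" "set h \<subseteq> verts G \<times> verts G"
    then have "last h \<in> verts G \<times> verts G" using last_in_set by blast
    then show "fst (last h) \<rightarrow>\<^bsub>G\<^esub> \<sigma> h"
      using \<sigma>[of h] loops by (cases "\<exists>e. Q h e") (auto simp: \<sigma>_def Q_def)
  qed
  moreover have "P t' (c' t') (x' (t' - 1))"
    if "t \<le> t'" "\<forall>i\<le>t. c' i = c i" "\<forall>i<t. x' i = x i" "play_upto G c' x' t'"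
      "\<forall>i. t \<le> i \<and> i < t' \<longrightarrow> c' (Suc i) = \<sigma> (history c' x' i)" for c' x' t'
    using that
  proof (induction rule: dec_induct)
    case base
    then show ?case using assms(2,3) by simp
  next
    case (step n)
    have play: "play_upto G c' x' n"
      using step.prems(3) by (auto simp: play_upto_def)
    have IH: "P n (c' n) (x' (n - 1))" using step.IH step.prems play by simp
    have n: "n = Suc (n - 1)" using step.hyps assms(2) by simp
    \<comment> \<open>After the cop's \<open>n\<close>-th move the robber is still at
      \<open>x' (n - 1)\<close>. That the play lasts for one more cop move shows that he is uncaught
      and moves legally to \<open>x' n\<close>.\<close>
    have "c' (Suc (n - 1)) \<noteq> x' (n - 1)" "x' (n - 1) \<rightarrow>\<^bsub>G\<^esub> x' (Suc (n - 1))"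
      using step.prems(3) n unfolding play_upto_def by (metis lessI)+
    then obtain e where "c' n \<rightarrow>\<^bsub>G\<^esub> e" "P (Suc n) e (x' n)"
      using assms(1)[OF _ IH] n by auto
    then have "Q (history c' x' n) e" by (simp add: Q_def history_def)
    then have "Q (history c' x' n) (c' (Suc n))"
      using \<sigma> step.prems(4) step.hyps by simp
    then show ?case by (simp add: Q_def history_def)
  qed
  ultimately show ?thesis unfolding cop_can_maintain_def by blast
qed

text \<open>An uncaught robber is not 0-cornered, so the level is positive and can drop by one
  together with the bound.\<close>

lemma cond_LW_step:
  assumes "graph_corner_rank G = enat \<alpha>" "cond_LW G \<alpha> r s d u" "d \<noteq> u" "u \<rightarrow>\<^bsub>G\<^esub> v"
  shows "\<exists>e. d \<rightarrow>\<^bsub>G\<^esub> e \<and> cond_LW G \<alpha> r (Suc s) e v"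
proof -
  obtain k where k: "int k \<le> int \<alpha> - int r - int s" "k_cornered G k d u"
    using assms(2) by (auto simp: cond_LW_def)
  with assms(3) obtain j where j: "k = Suc j" by (cases k) (auto simp: k_cornered_def)
  then obtain e where "d \<rightarrow>\<^bsub>G\<^esub> e" "k_cornered G j e v"
    using k_cornered_step[OF assms(1) _ _ assms(4), of j d] k by auto
  moreover have "int j \<le> int \<alpha> - int r - int (Suc s)" using k j by simp
  ultimately show ?thesis unfolding cond_LW_def by blast
qed

lemma cond_C_step:
  assumes "graph_corner_rank G = enat \<alpha>" "s \<ge> 1" "cond_C G \<alpha> r s d u" "d \<noteq> u" "u \<rightarrow>\<^bsub>G\<^esub> v"
  shows "\<exists>e. d \<rightarrow>\<^bsub>G\<^esub> e \<and> cond_C G \<alpha> r (Suc s) e v"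
proof -
  obtain k where k: "k \<ge> 1" "int k \<le> int \<alpha> - int r - int s + 1" "k_caught G k d u"
    using assms(3) by (auto simp: cond_C_def)
  \<comment> \<open>At level 1 the only shadow is the robber's own vertex.\<close>
  have "k \<noteq> 1" using k assms(4) by (auto simp: k_caught_def)
  with k(1) obtain j where j: "k = Suc j" "j \<ge> 1" by (cases k) auto
  \<comment> \<open>Because \<open>s\<close> \<ge> 1, the extra 1 in the bound still leaves
    \<open>Suc j\<close> \<le> \<alpha>, the range in which the projections are nonempty.\<close>
  then obtain e where "d \<rightarrow>\<^bsub>G\<^esub> e" "k_caught G j e v"
    using k_caught_step[OF assms(1) j(2) _ _ assms(5), of d] k assms(2) by auto
  moreover have "int j \<le> int \<alpha> - int r - int (Suc s) + 1" using k j by simp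
  ultimately show ?thesis unfolding cond_C_def using j by blast
qed

end

theorem theorem4p10:
  fixes G :: "('a, 'b) pre_digraph" and \<alpha> r :: nat
  assumes "reflexive_graph G"
    and "graph_corner_rank G = enat \<alpha>" and "\<alpha> \<ge> 2"
    and "r \<in> {0, 1}" and "cop_win_type G r"
  shows "(\<forall>t\<ge>1. \<forall>c x. play_upto G c x t \<and> cond_LW G \<alpha> r t (c t) (x (t - 1))
            \<longrightarrow> cop_can_maintain G (cond_LW G \<alpha> r) c x t) \<and>
         (\<forall>t\<ge>1. \<forall>c x. play_upto G c x t \<and> cond_C G \<alpha> r t (c t) (x (t - 1))
            \<longrightarrow> cop_can_maintain G (cond_C G \<alpha> r) c x t)"
proof -
  interpret reflexive_graph G by fact
  have "cop_can_maintain G (cond_LW G \<alpha> r) c x t"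
    if "t \<ge> 1" "cond_LW G \<alpha> r t (c t) (x (t - 1))" for t c x
    using that cond_LW_step[OF assms(2)] by (intro cop_can_maintain_if_step)
  moreover have "cop_can_maintain G (cond_C G \<alpha> r) c x t"
    if "t \<ge> 1" "cond_C G \<alpha> r t (c t) (x (t - 1))" for t c x
    using that cond_C_step[OF assms(2)] by (intro cop_can_maintain_if_step)
  ultimately show ?thesis by blast
qed

end
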